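(* Let $A=A^*$ be a selfadjoint linear operator on the $n$-dimensional Euclidean space $\mathbb{C}^n$, let $f\in R(A)$, and let $y$ be the minimal-norm solution of the linear system $Au=f$. For each $\delta>0$ let $f_\delta\in\mathbb{C}^n$ satisfy $\|f-f_\delta\|\le\delta$, and for $a>0$ let $u_{a,\delta}:[0,\infty)\to\mathbb{C}^n$ be the unique solution of the Cauchy problem $$\dot u_{a,\delta}(t)=i(A+iaI)u_{a,\delta}(t)+f_\delta,\qquad u_{a,\delta}(0)=0 .$$ If $t_\delta>0$ and $a(\delta)>0$ are such that $$\lim_{\delta\to 0}t_\delta=\infty,\quad \lim_{\delta\to 0}a(\delta)=0,\quad \lim_{\delta\to 0}\frac{\delta}{a(\delta)}=0,\quad \lim_{\delta\to 0}a(\delta)t_\delta=\infty,$$ then $$\lim_{\delta\to 0}\|u_\delta-iy\|=0,\qquad\text{where } u_\delta:=u_{a(\delta),\delta}(t_\delta).$$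
   Context: $R(A)$ denotes the range of $A$, $I$ is the identity operator, $i$ is the imaginary unit, $\dot u=du/dt$, and $\|\cdot\|$ is the Euclidean norm. $A$ is allowed to be singular. Let $N=\{u: Au=0\}$ be the null-space of $A$. The minimal-norm solution $y$ of $Au=f$ is the unique solution that is orthogonal to $N$. Limits $\delta\to 0$ are taken over $\delta>0$. *)

theory Defs
  imports "HOL-Analysis.Analysis"
begin

(* The library's inner product on complex ^ 'n is the real one (the real part of the form below);
   selfadjointness and orthogonality over the complex numbers need the Hermitian form.
   The norm of complex ^ 'n is already the Euclidean norm, i.e. the one induced by cinner. *)
definition cinner :: "complex ^ 'n \<Rightarrow> complex ^ 'n \<Rightarrow> complex" where
  "cinner x y = (\<Sum>k\<in>UNIV. x $ k * cnj (y $ k))"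

definition is_adjoint ::
  "(complex ^ 'n \<Rightarrow> complex ^ 'n) \<Rightarrow> (complex ^ 'n \<Rightarrow> complex ^ 'n) \<Rightarrow> bool" where
  "is_adjoint A B \<longleftrightarrow> (\<forall>x y. cinner (A x) y = cinner x (B y))"

(* Linearity is over the complex numbers: *s is scalar multiplication by a complex number,
   whereas the unqualified "linear" of the library is linearity over the reals. *)
definition selfadjoint_operator :: "(complex ^ 'n \<Rightarrow> complex ^ 'n) \<Rightarrow> bool" where
  "selfadjoint_operator A \<longleftrightarrow> Vector_Spaces.linear (*s) (*s) A \<and> is_adjoint A A"

definition null_space :: "(complex ^ 'n \<Rightarrow> complex ^ 'n) \<Rightarrow> (complex ^ 'n) set" where
  "null_space A = {u. A u = 0}"

definition minimal_norm_solution ::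
  "(complex ^ 'n \<Rightarrow> complex ^ 'n) \<Rightarrow> complex ^ 'n \<Rightarrow> complex ^ 'n \<Rightarrow> bool" where
  "minimal_norm_solution A f y \<longleftrightarrow> A y = f \<and> (\<forall>v\<in>null_space A. cinner y v = 0)"

(* u solves u' = i (A + i a I) u + g, u 0 = 0 on [0, \<infinity>); the derivative at 0 is one-sided and
   values of u at negative arguments are irrelevant. *)
definition solves_cauchy_problem ::
  "(complex ^ 'n \<Rightarrow> complex ^ 'n) \<Rightarrow> real \<Rightarrow> complex ^ 'n \<Rightarrow> (real \<Rightarrow> complex ^ 'n) \<Rightarrow> bool" where
  "solves_cauchy_problem A a g u \<longleftrightarrow>
     u 0 = 0 \<and>
     (\<forall>t\<ge>0. (u has_vector_derivative
               (\<i> *s (A (u t) + (\<i> * complex_of_real a) *s u t) + g)) (at t within {0..}))"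

end

theory Submission imports Defs begin

text \<open>
  The point \<open>i y\<close> is almost stationary for the flow \<open>u' = i (A + i a I) u + f\<^sub>\<delta>\<close>: substituting
  it leaves the residual \<open>f\<^sub>\<delta> - f - a i y\<close>. The first part has norm at most \<open>\<delta>\<close>, which
  after division by the damping rate \<open>a\<close> tends to zero. The second part has the size of \<open>a\<close>
  itself, so the damping alone does not make it harmless. What helps is that \<open>y\<close>, being
  orthogonal to the null-space of the selfadjoint \<open>A\<close>, lies in the range of \<open>A\<close>
  (\<open>orthogonal_to_null_space_in_range\<close>). If \<open>y = A z\<close>, then moving the centre from \<open>i y\<close> to
  \<open>i y + a z\<close> cancels the term \<open>a i y\<close> and leaves the residual \<open>f\<^sub>\<delta> - f - a\<^sup>2 z\<close>, of norm
  at most \<open>\<delta> + a\<^sup>2 \<parallel>z\<parallel>\<close>.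

  The deviation \<open>v\<close> from the moved centre satisfies \<open>v' = i A v - a v + g\<close> with that residual
  \<open>g\<close>. Since \<open>A\<close> is selfadjoint, \<open>i A v\<close> is orthogonal to \<open>v\<close> in the real inner product, so
  it does not change \<open>\<parallel>v\<parallel>\<close>, and an energy estimate (\<open>damped_skew_flow_bound\<close>) gives
  \<open>\<parallel>v(t)\<parallel>\<^sup>2 \<le> e\<^sup>-\<^sup>a\<^sup>t \<parallel>v(0)\<parallel>\<^sup>2 + (\<parallel>g\<parallel> / a)\<^sup>2\<close>. Here \<open>\<parallel>g\<parallel> / a \<le> \<delta> / a + a \<parallel>z\<parallel>\<close>, and every
  term tends to zero because \<open>a t\<close> tends to infinity while \<open>a\<close> and \<open>\<delta> / a\<close> tend to zero.
\<close>

lemma inner_eq_Re_cinner: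
  fixes x y :: "complex ^ 'n"
  shows "x \<bullet> y = Re (cinner x y)"
  by (simp add: cinner_def inner_vec_def inner_complex_def)

lemma cinner_commute: "cinner y x = cnj (cinner x y)"
  by (simp add: cinner_def mult.commute)

lemma cinner_scale_right: "cinner x (c *s y) = cnj c * cinner x y"
  by (simp add: cinner_def sum_distrib_left algebra_simps)

lemma norm_vector_scalar_mult:
  fixes x :: "complex ^ 'n"
  shows "norm (c *s x) = cmod c * norm x"
  by (simp add: norm_vec_def norm_mult L2_set_right_distrib)

lemma scaleR_eq_scalar_mult:
  fixes x :: "complex ^ 'n"
  shows "r *\<^sub>R x = complex_of_real r *s x"
  unfolding vec_eq_iff vector_scaleR_component vector_smult_component by (simp add: scaleR_conv_of_real)

context
  fixes A :: "complex ^ 'n \<Rightarrow> complex ^ 'n"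
  assumes selfadj: "selfadjoint_operator A"
begin

lemma selfadjoint_add: "A (x + y) = A x + A y"
  using selfadj by (simp add: selfadjoint_operator_def vec.linear_add)

lemma selfadjoint_scale: "A (c *s x) = c *s A x"
  using selfadj by (simp add: selfadjoint_operator_def vec.linear_scale)

lemma selfadjoint_real_linear: "linear A"
  by (rule linearI) (simp_all add: selfadjoint_add selfadjoint_scale scaleR_eq_scalar_mult)

lemma selfadjoint_inner: "A x \<bullet> y = x \<bullet> A y"
  using selfadj
  by (simp add: selfadjoint_operator_def is_adjoint_def inner_eq_Re_cinner)

text \<open>The quadratic form of a selfadjoint operator is real, so multiplication by \<open>i\<close> makes it
  imaginary.\<close>

lemma selfadjoint_imaginary_orthogonal: "x \<bullet> (\<i> *s A x) = 0"
proof -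
  have "cinner x (A x) = cnj (cinner x (A x))"
    using selfadj cinner_commute[of "A x" x]
    by (simp add: selfadjoint_operator_def is_adjoint_def)
  then have "Im (cinner x (A x)) = 0"
    by (metis Reals_cnj_iff complex_is_Real_iff)
  then show ?thesis
    by (simp add: inner_eq_Re_cinner cinner_scale_right)
qed

text \<open>In finite dimension the range is a closed subspace, and for a selfadjoint operator its
  orthogonal complement is the null-space. Thus the component of \<open>y\<close> perpendicular to the range
  lies in the null-space and must vanish.\<close>

lemma orthogonal_to_null_space_in_range:
  assumes orth: "\<And>v. v \<in> null_space A \<Longrightarrow> cinner y v = 0"
  shows "y \<in> range A"
proof -
  have sub: "subspace (range A)"
    using linear_subspace_image[OF selfadjoint_real_linear subspace_UNIV] .
  obtain p q where p: "p \<in> span (range A)"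
    and q: "\<And>w. w \<in> span (range A) \<Longrightarrow> orthogonal q w" and y: "y = p + q"
    using orthogonal_subspace_decomp_exists[of "range A" y] by metis
  have "A q \<bullet> A q = 0"
    using q[OF span_base[of "A (A q)"]] by (simp add: selfadjoint_inner orthogonal_def)
  then have "q \<in> null_space A"
    by (simp add: null_space_def)
  then have "y \<bullet> q = 0"
    using orth by (simp add: inner_eq_Re_cinner)
  moreover have "p \<bullet> q = 0"
    using q[OF p] by (simp add: orthogonal_def inner_commute)
  ultimately have "q = 0"
    by (simp add: y inner_add_left)
  then show ?thesis
    using p y sub by (metis add.right_neutral span_eq_iff)
qed

end

text \<open>An energy \<open>E\<close> that decays at rate \<open>a\<close> and is fed at rate \<open>b\<close> is compared with the
  equilibrium level \<open>b / a\<close>: the excess over this level, multiplied by the integrating factor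
  \<open>e\<^sup>a\<^sup>t\<close>, does not increase.\<close>

lemma linear_decay_bound:
  fixes E :: "real \<Rightarrow> real"
  assumes a: "a > 0" and T: "T \<ge> 0"
    and deriv: "\<And>t. t \<ge> 0 \<Longrightarrow> (E has_real_derivative E' t) (at t within {0..})"
    and ineq: "\<And>t. t \<ge> 0 \<Longrightarrow> E' t \<le> - a * E t + b"
  shows "E T \<le> exp (- (a * T)) * (E 0 - b / a) + b / a"
proof -
  define h where "h t = exp (a * t) * (E t - b / a)" for t
  have dh: "(h has_real_derivative exp (a * t) * (a * E t - b + E' t)) (at t within {0..})"
    if "t \<ge> 0" for t
    unfolding h_def using a
    by (auto intro!: derivative_eq_intros deriv that simp: field_simps)
  \<comment> \<open>Only the one-sided derivative is available at 0, hence the comparison on the open interval.\<close>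
  have "h T \<le> h 0"
  proof (rule DERIV_nonpos_imp_decreasing_open[OF T])
    fix t :: real assume t: "0 < t" "t < T"
    have "at t within {0..} = at t"
      using t by (intro at_within_interior) auto
    moreover have "exp (a * t) * (a * E t - b + E' t) \<le> 0"
      using ineq[of t] t by (intro mult_nonneg_nonpos) auto
    ultimately show "\<exists>y. DERIV h t :> y \<and> y \<le> 0"
      using dh[of t] t by auto
  next
    have "continuous_on {0..} h"
      by (rule DERIV_continuous_on[OF dh]) simp
    then show "continuous_on {0..T} h"
      by (rule continuous_on_subset) auto
  qed
  then have "exp (- (a * T)) * h T \<le> exp (- (a * T)) * h 0"
    by simp
  moreover have "exp (- (a * T)) * h T = E T - b / a"
    by (simp add: h_def exp_minus)
  moreover have "h 0 = E 0 - b / a"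
    by (simp add: h_def)
  ultimately show ?thesis
    by simp
qed

text \<open>The skew part \<open>K\<close> drops out of the derivative of the energy \<open>\<parallel>v\<parallel>\<^sup>2\<close>. The forcing is
  absorbed by half of the damping, and the squared norm is used because it is differentiable
  also where \<open>v\<close> vanishes.\<close>

lemma damped_skew_flow_bound:
  fixes v :: "real \<Rightarrow> 'a::real_inner"
  assumes a: "a > 0" and T: "T \<ge> 0"
    and deriv: "\<And>t. t \<ge> 0 \<Longrightarrow> (v has_vector_derivative (K (v t) - a *\<^sub>R v t + g)) (at t within {0..})"
    and skew: "\<And>x. x \<bullet> K x = 0"
    and g: "norm g \<le> M"
  shows "(norm (v T))\<^sup>2 \<le> exp (- (a * T)) * (norm (v 0))\<^sup>2 + (M / a)\<^sup>2"
proof -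
  have "v T \<bullet> v T \<le> exp (- (a * T)) * (v 0 \<bullet> v 0 - (M\<^sup>2 / a) / a) + (M\<^sup>2 / a) / a"
  proof (rule linear_decay_bound[OF a T])
    fix t :: real assume t: "t \<ge> 0"
    show "((\<lambda>t. v t \<bullet> v t) has_real_derivative
        (2 * (v t \<bullet> (K (v t) - a *\<^sub>R v t + g)))) (at t within {0..})"
      using bounded_bilinear.has_vector_derivative[OF bounded_bilinear_inner deriv[OF t] deriv[OF t]]
      by (simp add: has_real_derivative_iff_has_vector_derivative inner_commute)
    have "v t \<bullet> g \<le> norm (v t) * M"
      using norm_cauchy_schwarz[of "v t" g] mult_left_mono[OF g, of "norm (v t)"] by simp
    moreover have "2 * (norm (v t) * M) \<le> a * (norm (v t))\<^sup>2 + M\<^sup>2 / a"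
    proof -
      have "0 \<le> (a * norm (v t) - M)\<^sup>2 / a"
        using a by simp
      also have "\<dots> = a * (norm (v t))\<^sup>2 + M\<^sup>2 / a - 2 * (norm (v t) * M)"
        using a by (simp add: field_simps power2_eq_square)
      finally show ?thesis by simp
    qed
    ultimately show "2 * (v t \<bullet> (K (v t) - a *\<^sub>R v t + g)) \<le> - a * (v t \<bullet> v t) + M\<^sup>2 / a"
      by (simp add: inner_add_right inner_diff_right skew power2_norm_eq_inner)
  qed
  moreover have "0 \<le> exp (- (a * T)) * (M / a)\<^sup>2"
    by simp
  moreover have "M\<^sup>2 / a / a = (M / a)\<^sup>2"
    by (simp add: power2_eq_square)
  ultimately show ?thesis
    by (simp only: power2_norm_eq_inner right_diff_distrib)
qed

text \<open>The whole estimate before passing to the limit. If \<open>z\<close> is chosen orthogonal to the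
  null-space, the centre \<open>i y + a z\<close> is the first-order expansion in \<open>a\<close> of the noise-free
  stationary point \<open>i (A + i a I)\<^sup>-\<^sup>1 A y\<close>. For any other \<open>z\<close> with \<open>A z = y\<close> the centre moves by
  \<open>a\<close> times a null vector, on which the generator is of order \<open>a\<close>. So the residual is always
  of second order.\<close>

lemma cauchy_problem_error_bound:
  fixes A :: "complex ^ 'n \<Rightarrow> complex ^ 'n"
  assumes A: "selfadjoint_operator A"
    and u: "solves_cauchy_problem A a g u"
    and a: "a > 0" and T: "T \<ge> 0"
    and noise: "norm (A y - g) \<le> \<delta>"
    and z: "y = A z"
  shows "norm (u T - \<i> *s y) \<le>
    sqrt (exp (- (a * T)) * (norm y + a * norm z)\<^sup>2 + (\<delta> / a + a * norm z)\<^sup>2) + a * norm z"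
proof -
  define v where "v t = u t - (\<i> *s y + a *\<^sub>R z)" for t
  define r where "r = g - A y - a\<^sup>2 *\<^sub>R z"
  have u0: "u 0 = 0"
    and du: "\<And>t. t \<ge> 0 \<Longrightarrow> (u has_vector_derivative
      (\<i> *s (A (u t) + (\<i> * complex_of_real a) *s u t) + g)) (at t within {0..})"
    using u by (auto simp: solves_cauchy_problem_def)
  \<comment> \<open>The terms \<open>i A (a z) = a i y\<close> and \<open>- a (i y)\<close> cancel here.\<close>
  have rhs: "\<i> *s (A (u t) + (\<i> * complex_of_real a) *s u t) + g
      = \<i> *s A (v t) - a *\<^sub>R v t + r" for t
  proof -
    have ut: "u t = v t + \<i> *s y + complex_of_real a *s z"
      by (simp add: v_def scaleR_eq_scalar_mult)
    have "A (u t) = A (v t) + \<i> *s A y + complex_of_real a *s y"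
      by (simp add: ut selfadjoint_add[OF A] selfadjoint_scale[OF A] z)
    then show ?thesis
      by (simp add: ut r_def scaleR_eq_scalar_mult vec_eq_iff algebra_simps power2_eq_square)
  qed
  have dv: "(v has_vector_derivative (\<i> *s A (v t) - a *\<^sub>R v t + r)) (at t within {0..})"
    if "t \<ge> 0" for t
    unfolding v_def[abs_def]
    using has_vector_derivative_diff[OF du[OF that] has_vector_derivative_const]
    unfolding rhs by (simp add: v_def)
  have "norm r \<le> norm (g - A y) + norm (a\<^sup>2 *\<^sub>R z)"
    unfolding r_def by (rule norm_triangle_ineq4)
  then have "norm r \<le> \<delta> + a\<^sup>2 * norm z"
    using noise by (simp add: norm_minus_commute)
  then have "(norm (v T))\<^sup>2 \<le> exp (- (a * T)) * (norm (v 0))\<^sup>2 + ((\<delta> + a\<^sup>2 * norm z) / a)\<^sup>2"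
    using a T dv selfadjoint_imaginary_orthogonal[OF A]
    by (intro damped_skew_flow_bound[where K = "\<lambda>x. \<i> *s A x"])
  moreover have "(\<delta> + a\<^sup>2 * norm z) / a = \<delta> / a + a * norm z"
    using a by (simp add: field_simps power2_eq_square)
  moreover have "(norm (v 0))\<^sup>2 \<le> (norm y + a * norm z)\<^sup>2"
  proof (rule power_mono)
    have "norm (v 0) = norm (\<i> *s y + a *\<^sub>R z)"
      by (simp only: v_def u0 diff_0 norm_minus_cancel)
    also have "\<dots> \<le> norm (\<i> *s y) + norm (a *\<^sub>R z)"
      by (rule norm_triangle_ineq)
    finally show "norm (v 0) \<le> norm y + a * norm z"
      using a by (simp add: norm_vector_scalar_mult)
  qed simp
  ultimately have "(norm (v T))\<^sup>2
      \<le> exp (- (a * T)) * (norm y + a * norm z)\<^sup>2 + (\<delta> / a + a * norm z)\<^sup>2"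
    by (smt (verit) mult_left_mono exp_ge_zero)
  then have "norm (v T)
      \<le> sqrt (exp (- (a * T)) * (norm y + a * norm z)\<^sup>2 + (\<delta> / a + a * norm z)\<^sup>2)"
    by (rule real_le_rsqrt)
  moreover have "norm (u T - \<i> *s y) \<le> norm (v T) + a * norm z"
    using norm_triangle_ineq[of "v T" "a *\<^sub>R z"] a by (simp add: v_def)
  ultimately show ?thesis by simp
qed

theorem theorem2:
  fixes A :: "complex ^ 'n \<Rightarrow> complex ^ 'n"
    and f y :: "complex ^ 'n"
    and f\<^sub>\<delta> :: "real \<Rightarrow> complex ^ 'n"
    and u :: "real \<Rightarrow> real \<Rightarrow> real \<Rightarrow> complex ^ 'n"
    and t a :: "real \<Rightarrow> real"
  assumes "selfadjoint_operator A"
    and "f \<in> range A"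
    and "minimal_norm_solution A f y"
    and "\<And>\<delta>. \<delta> > 0 \<Longrightarrow> norm (f - f\<^sub>\<delta> \<delta>) \<le> \<delta>"
    and "\<And>\<alpha> \<delta>. \<alpha> > 0 \<Longrightarrow> \<delta> > 0 \<Longrightarrow> solves_cauchy_problem A \<alpha> (f\<^sub>\<delta> \<delta>) (u \<alpha> \<delta>)"
    and "\<And>\<delta>. \<delta> > 0 \<Longrightarrow> t \<delta> > 0"
    and "\<And>\<delta>. \<delta> > 0 \<Longrightarrow> a \<delta> > 0"
    and "filterlim t at_top (at_right 0)"
    and "(a \<longlongrightarrow> 0) (at_right 0)"
    and "((\<lambda>\<delta>. \<delta> / a \<delta>) \<longlongrightarrow> 0) (at_right 0)"
    and "filterlim (\<lambda>\<delta>. a \<delta> * t \<delta>) at_top (at_right 0)"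
  shows "((\<lambda>\<delta>. norm (u (a \<delta>) \<delta> (t \<delta>) - \<i> *s y)) \<longlongrightarrow> 0) (at_right 0)"
proof -
  have Ay: "A y = f" and orth: "\<And>v. v \<in> null_space A \<Longrightarrow> cinner y v = 0"
    using assms(3) by (auto simp: minimal_norm_solution_def)
  obtain z where z: "y = A z"
    using orthogonal_to_null_space_in_range[OF assms(1) orth] by blast
  define B where "B \<delta> = sqrt (exp (- (a \<delta> * t \<delta>)) * (norm y + a \<delta> * norm z)\<^sup>2
      + (\<delta> / a \<delta> + a \<delta> * norm z)\<^sup>2) + a \<delta> * norm z" for \<delta>
  have "norm (u (a \<delta>) \<delta> (t \<delta>) - \<i> *s y) \<le> B \<delta>" if "\<delta> > 0" for \<delta>
    unfolding B_def
    by (rule cauchy_problem_error_bound[OF assms(1)])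
      (use that assms(4-7) z Ay in \<open>auto intro: less_imp_le\<close>)
  then have le: "\<forall>\<^sub>F \<delta> in at_right 0. norm (u (a \<delta>) \<delta> (t \<delta>) - \<i> *s y) \<le> B \<delta>"
    by (intro eventually_at_right_less[THEN eventually_mono])
  have decay: "((\<lambda>\<delta>. exp (- (a \<delta> * t \<delta>))) \<longlongrightarrow> 0) (at_right 0)"
    by (intro filterlim_compose[OF exp_at_bot]
        filterlim_compose[OF filterlim_uminus_at_bot_at_top] assms(11))
  have "(B \<longlongrightarrow> sqrt (0 * (norm y + 0 * norm z)\<^sup>2 + (0 + 0 * norm z)\<^sup>2) + 0 * norm z) (at_right 0)"
    unfolding B_def[abs_def] by (intro tendsto_intros decay assms(9,10))
  then have "(B \<longlongrightarrow> 0) (at_right 0)"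
    by simp
  then show ?thesis
    by (rule tendsto_sandwich[OF _ le tendsto_const, rotated]) simp
qed

end
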